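(* Let $d\ge1$, $p\ge 2$, let $\mathbb X\subset\mathbb R^d$ be open, and for $1\le k\le p$ let $\psi_k=(\psi_{k,1},\dots,\psi_{k,n_k})^T:\mathbb X\to\mathbb R^{n_k}$ be a vector of twice continuously differentiable functions. For $x\in\mathbb X$ let $\nabla\boldsymbol\Psi(x)\in\mathbb R^{n_1\times\cdots\times n_p\times d}$ be the tensor of order $p+1$ with entries $$\nabla\boldsymbol\Psi(x)_{u_1,\dots,u_p,i}=\frac{\partial}{\partial x^i}\big(\psi_{1,u_1}\cdot\ldots\cdot\psi_{p,u_p}\big)(x).$$ Then $\nabla\boldsymbol\Psi(x)$ has the tensor train representation $\nabla\boldsymbol\Psi(x)=[\![\nabla\boldsymbol\Psi^{(1)}(x)]\!]\otimes\cdots\otimes[\![\nabla\boldsymbol\Psi^{(p+1)}(x)]\!]$ with ranks $r_1=\cdots=r_{p-1}=d+1$, $r_p=d$ and cores $$[\![\nabla\boldsymbol\Psi^{(1)}(x)]\!]=\begin{bmatrix}\psi_1(x)&\frac{\partial\psi_1}{\partial x^1}(x)&\cdots&\frac{\partial\psi_1}{\partial x^d}(x)\end{bmatrix},$$ $$[\![\nabla\boldsymbol\Psi^{(k)}(x)]\!]=\begin{bmatrix}\psi_k(x)&\frac{\partial\psi_k}{\partial x^1}(x)&\cdots&\frac{\partial\psi_k}{\partial x^d}(x)\\0&\psi_k(x)&&0\\\vdots&&\ddots&\\0&0&&\psi_k(x)\end{bmatrix}\quad(2\le k\le p-1),$$ $$[\![\nabla\boldsymbol\Psi^{(p)}(x)]\!]=\begin{bmatrix}\frac{\partial\psi_p}{\partial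 x^1}(x)&\cdots&\frac{\partial\psi_p}{\partial x^d}(x)\\\psi_p(x)&&0\\&\ddots&\\0&&\psi_p(x)\end{bmatrix},\qquad[\![\nabla\boldsymbol\Psi^{(p+1)}(x)]\!]=\begin{bmatrix}e_1&\cdots&e_d\end{bmatrix}^T,$$ where $e_1,\dots,e_d$ are the canonical unit vectors of $\mathbb R^d$.
   Context: $x^i$ denotes the $i$-th coordinate of $x\in\mathbb R^d$; $\frac{\partial\psi_k}{\partial x^i}(x)\in\mathbb R^{n_k}$ is the vector of partial derivatives of all $\psi_{k,u}$. The tensor product of vectors $v^{(k)}\in\mathbb R^{n_k}$ is $(v^{(1)}\otimes\cdots\otimes v^{(q)})_{u_1,\dots,u_q}=\prod_{k=1}^q v^{(k)}_{u_k}$. Tensor train (TT) format: given cores $\mathbf T^{(k)}\in\mathbb R^{r_{k-1}\times n_k\times r_k}$, $k=1,\dots,q$, with $r_0=r_q=1$, the associated tensor of order $q$ is $$\mathbf T=\sum_{s_0=1}^{r_0}\cdots\sum_{s_q=1}^{r_q}\mathbf T^{(1)}_{s_0,:,s_1}\otimes\cdots\otimes\mathbf T^{(q)}_{s_{q-1},:,s_q}.$$ The $r_k$ are the TT ranks (sizes of the cores of the representation). Rank-core notation: $[\![\mathbf T^{(k)}]\!]$ is the $r_{k-1}\times r_k$ matrix whose $(s,t)$ entry is the vector $\mathbf T^{(k)}_{s,:,t}\in\mathbb R^{n_k}$; $[\![\mathbf T^{(1)}]\!]\otimes\cdots\otimes[\![\mathbf T^{(q)}]\!]$ is the formal matrix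 product in which entries are multiplied by $\otimes$, and it equals the sum above. An entry $0$ is the zero vector. Here $q=p+1$ and $n_{p+1}=d$. *)

theory Defs
  imports "HOL-Analysis.Analysis"
begin

section \<open>Tensors and the tensor train format\<close>

text \<open>
  All indices start at 1.  A vector of \<open>\<real>\<^sup>n\<close> is a function on \<open>{1..n}\<close>, extended arbitrarily to
  \<^typ>\<open>nat\<close>; a tensor of order \<open>q\<close> with mode sizes \<open>n 1, \<dots>, n q\<close> is likewise a function on
  \<open>multi_indices q n\<close>.
\<close>

type_synonym tensor = "(nat \<Rightarrow> nat) \<Rightarrow> real"

definition multi_indices :: "nat \<Rightarrow> (nat \<Rightarrow> nat) \<Rightarrow> (nat \<Rightarrow> nat) set" where
  "multi_indices q n = (\<Pi>\<^sub>E k\<in>{1..q}. {1..n k})"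

definition tensor_product :: "nat \<Rightarrow> (nat \<Rightarrow> nat \<Rightarrow> real) \<Rightarrow> tensor" where
  "tensor_product q v = (\<lambda>u. \<Prod>k=1..q. v k (u k))"

text \<open>
  A core is stored in rank-core form: \<open>T k s t\<close> is the vector in row \<open>s\<close> and column \<open>t\<close> of the
  \<open>r (k - 1) \<times> r k\<close> matrix belonging to the \<open>k\<close>-th core.
\<close>

type_synonym core = "nat \<Rightarrow> nat \<Rightarrow> nat \<Rightarrow> real"

definition tt_tensor :: "nat \<Rightarrow> (nat \<Rightarrow> nat) \<Rightarrow> (nat \<Rightarrow> core) \<Rightarrow> tensor" where
  "tt_tensor q r T =
    (\<lambda>u. \<Sum>s\<in>(\<Pi>\<^sub>E k\<in>{0..q}. {1..r k}). tensor_product q (\<lambda>k. T k (s (k - 1)) (s k)) u)"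

definition tt_representation ::
    "nat \<Rightarrow> (nat \<Rightarrow> nat) \<Rightarrow> (nat \<Rightarrow> nat) \<Rightarrow> (nat \<Rightarrow> core) \<Rightarrow> tensor \<Rightarrow> bool" where
  "tt_representation q n r T A \<longleftrightarrow>
     r 0 = 1 \<and> r q = 1 \<and> (\<forall>u\<in>multi_indices q n. A u = tt_tensor q r T u)"

text \<open>
  The \<open>(s, t)\<close> entry of the formal matrix product of the first \<open>q\<close> rank-core matrices, a tensor of
  order \<open>q\<close>: it reads \<open>u 1, \<dots>, u q\<close> only, so that multiplying by a value at \<open>u (Suc q)\<close> is the
  tensor product with a further vector.  The empty product is the identity matrix over tensors
  of order 0.
\<close>

primrec rank_core_product ::
    "(nat \<Rightarrow> nat) \<Rightarrow> (nat \<Rightarrow> core) \<Rightarrow> nat \<Rightarrow> nat \<Rightarrow> nat \<Rightarrow> tensor" where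
  "rank_core_product r T 0 s t = (\<lambda>u. if s = t then 1 else 0)"
| "rank_core_product r T (Suc q) s t =
    (\<lambda>u. \<Sum>m=1..r q. rank_core_product r T q s m u * T (Suc q) m t (u (Suc q)))"


section \<open>Differentiability\<close>

definition C2_on :: "'a::real_normed_vector set \<Rightarrow> ('a \<Rightarrow> 'b::real_normed_vector) \<Rightarrow> bool" where
  "C2_on X f \<longleftrightarrow>
    (\<exists>(f' :: 'a \<Rightarrow> 'a \<Rightarrow>\<^sub>L 'b) (f'' :: 'a \<Rightarrow> 'a \<Rightarrow>\<^sub>L 'a \<Rightarrow>\<^sub>L 'b).
       (\<forall>x\<in>X. (f has_derivative blinfun_apply (f' x)) (at x)) \<and>
       (\<forall>x\<in>X. (f' has_derivative blinfun_apply (f'' x)) (at x)) \<and>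
       continuous_on X f'')"

definition partial_deriv :: "'d::finite \<Rightarrow> (real^'d \<Rightarrow> real) \<Rightarrow> real^'d \<Rightarrow> real" where
  "partial_deriv i f x = deriv (\<lambda>h. f (x + h *\<^sub>R axis i 1)) 0"


section \<open>The gradient tensor and its cores\<close>

text \<open>
  \<open>\<psi> k x u\<close> is the value at \<open>x\<close> of the \<open>u\<close>-th component of \<open>\<psi>\<^sub>k\<close>.  Since the coordinates of
  \<^typ>\<open>real^'d\<close> carry no order, a bijection \<open>c\<close> from \<open>{1..CARD('d)}\<close> to \<^typ>\<open>'d\<close> numbers them:
  the \<open>i\<close>-th coordinate of \<open>x\<close> is \<open>x $ c i\<close>.
\<close>

definition grad_tensor ::
    "(nat \<Rightarrow> 'd::finite) \<Rightarrow> nat \<Rightarrow> (nat \<Rightarrow> real^'d \<Rightarrow> nat \<Rightarrow> real) \<Rightarrow> real^'d \<Rightarrow> tensor" where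
  "grad_tensor c p \<psi> x =
    (\<lambda>u. partial_deriv (c (u (p + 1))) (\<lambda>y. \<Prod>k=1..p. \<psi> k y (u k)) x)"

definition grad_rank :: "nat \<Rightarrow> nat \<Rightarrow> nat \<Rightarrow> nat" where
  "grad_rank p d k =
    (if k = 0 \<or> k = p + 1 then 1 else if k = p then d else d + 1)"

definition partial_vec ::
    "(nat \<Rightarrow> 'd::finite) \<Rightarrow> nat \<Rightarrow> (real^'d \<Rightarrow> nat \<Rightarrow> real) \<Rightarrow> real^'d \<Rightarrow> nat \<Rightarrow> real" where
  "partial_vec c i f x = (\<lambda>u. partial_deriv (c i) (\<lambda>y. f y u) x)"

definition unit_vec :: "nat \<Rightarrow> nat \<Rightarrow> real" where
  "unit_vec i = (\<lambda>j. if j = i then 1 else 0)"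

definition grad_core ::
    "(nat \<Rightarrow> 'd::finite) \<Rightarrow> nat \<Rightarrow> (nat \<Rightarrow> real^'d \<Rightarrow> nat \<Rightarrow> real) \<Rightarrow> real^'d \<Rightarrow> nat \<Rightarrow> core" where
  "grad_core c p \<psi> x k s t =
    (if k = 1 then
       (if t = 1 then \<psi> 1 x else partial_vec c (t - 1) (\<psi> 1) x)
     else if k < p then
       (if s = 1 \<and> t \<noteq> 1 then partial_vec c (t - 1) (\<psi> k) x
        else if s = t then \<psi> k x
        else (\<lambda>_. 0))
     else if k = p then
       (if s = 1 then partial_vec c t (\<psi> p) x
        else if s = t + 1 then \<psi> p x
        else (\<lambda>_. 0))
     else unit_vec s)"

end

theory Submission
  imports Defs
begin

text \<open>
  The formal matrix product of the first \<open>q < p\<close> cores is the row vector with entries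
  \<open>\<psi>\<^sub>1 \<otimes> \<dots> \<otimes> \<psi>\<^sub>q\<close> and its \<open>d\<close> partial derivatives: multiplying it by the next
  core is exactly the product rule.  The \<open>p\<close>-th core drops the first entry, and the last core turns
  the remaining row of partial derivatives into the gradient.
\<close>

text \<open>Splitting off the last index is a bijection
  \<open>(t, s) \<mapsto> s(Suc q := t)\<close>. The new index ends up innermost, so that for fixed
  \<open>s\<close> its sum can be turned into a weight.\<close>

lemma sum_PiE_atLeastAtMost_Suc:
  fixes F :: "(nat \<Rightarrow> nat) \<Rightarrow> real"
  shows "(\<Sum>s\<in>(\<Pi>\<^sub>E k\<in>{0..Suc q}. A k). F s) =
    (\<Sum>s\<in>(\<Pi>\<^sub>E k\<in>{0..q}. A k). \<Sum>t\<in>A (Suc q). F (s(Suc q := t)))"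
proof -
  have "(\<Sum>s\<in>(\<Pi>\<^sub>E k\<in>{0..Suc q}. A k). F s) =
      (\<Sum>(t, s)\<in>A (Suc q) \<times> (\<Pi>\<^sub>E k\<in>{0..q}. A k). F (s(Suc q := t)))"
    unfolding atLeast0_atMost_Suc PiE_insert_eq
    by (subst sum.reindex [OF inj_combinator]) (auto simp: case_prod_unfold)
  also have "\<dots> = (\<Sum>t\<in>A (Suc q). \<Sum>s\<in>(\<Pi>\<^sub>E k\<in>{0..q}. A k). F (s(Suc q := t)))"
    by (rule sum.cartesian_product [symmetric])
  also have "\<dots> = (\<Sum>s\<in>(\<Pi>\<^sub>E k\<in>{0..q}. A k). \<Sum>t\<in>A (Suc q). F (s(Suc q := t)))"
    by (rule sum.swap)
  finally show ?thesis .
qed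

text \<open>The weight \<open>g\<close> absorbs the next core in the induction step.\<close>

lemma sum_PiE_tensor_product_eq_rank_core_product:
  "(\<Sum>s\<in>(\<Pi>\<^sub>E k\<in>{0..q}. {1..r k}). tensor_product q (\<lambda>k. T k (s (k - 1)) (s k)) u * g (s q)) =
    (\<Sum>t=1..r q. \<Sum>a=1..r 0. rank_core_product r T q a t u * g t)"
proof (induction q arbitrary: g)
  case 0
  \<comment> \<open>A single index remains: an extensional function on \<open>{0}\<close> is
    determined by its value at 0.\<close>
  have "(\<Sum>s\<in>(\<Pi>\<^sub>E k\<in>{0::nat}. {1..r k}). g (s 0)) = (\<Sum>t=1..r 0. g t)"
    by (rule sum.reindex_bij_witness [of _ "\<lambda>t. \<lambda>k\<in>{0}. t" "\<lambda>s. s 0"])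
      (auto simp: PiE_iff extensional_def restrict_def fun_eq_iff)
  moreover have "(\<Sum>a=1..r 0. (if a = t then 1 else 0) * g t) = g t" if "t \<in> {1..r 0}" for t
    using that by (simp flip: sum_distrib_right)
  ultimately show ?case
    by (simp add: tensor_product_def)
next
  case (Suc q)
  let ?P = "\<lambda>q s. tensor_product q (\<lambda>k. T k (s (k - 1)) (s k)) u"
  have upd: "?P (Suc q) (s(Suc q := t)) = ?P q s * T (Suc q) (s q) t (u (Suc q))" for s t
  proof -
    \<comment> \<open>The first \<open>q\<close> factors read \<open>s\<close> only at positions up
      to \<open>q\<close>, so the update reaches only the last factor.\<close>
    have "(\<Prod>k=1..q. T k ((s(Suc q := t)) (k - 1)) ((s(Suc q := t)) k) (u k)) =
        (\<Prod>k=1..q. T k (s (k - 1)) (s k) (u k))"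
      by (rule prod.cong) auto
    then show ?thesis
      by (simp add: tensor_product_def)
  qed
  have "(\<Sum>s\<in>(\<Pi>\<^sub>E k\<in>{0..Suc q}. {1..r k}). ?P (Suc q) s * g (s (Suc q))) =
      (\<Sum>s\<in>(\<Pi>\<^sub>E k\<in>{0..q}. {1..r k}).
         ?P q s * (\<Sum>t=1..r (Suc q). T (Suc q) (s q) t (u (Suc q)) * g t))"
    by (simp only: sum_PiE_atLeastAtMost_Suc upd fun_upd_same sum_distrib_left mult.assoc)
  also have "\<dots> = (\<Sum>m=1..r q. \<Sum>a=1..r 0. rank_core_product r T q a m u *
      (\<Sum>t=1..r (Suc q). T (Suc q) m t (u (Suc q)) * g t))"
    by (rule Suc.IH)
  \<comment> \<open>The interchanges move \<open>m\<close> innermost, where its sum is the recursion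
    of the formal matrix product.\<close>
  also have "\<dots> = (\<Sum>m=1..r q. \<Sum>t=1..r (Suc q). \<Sum>a=1..r 0.
      rank_core_product r T q a m u * (T (Suc q) m t (u (Suc q)) * g t))"
    unfolding sum_distrib_left by (intro sum.cong refl sum.swap)
  also have "\<dots> = (\<Sum>t=1..r (Suc q). \<Sum>m=1..r q. \<Sum>a=1..r 0.
      rank_core_product r T q a m u * (T (Suc q) m t (u (Suc q)) * g t))"
    by (rule sum.swap)
  also have "\<dots> = (\<Sum>t=1..r (Suc q). \<Sum>a=1..r 0. \<Sum>m=1..r q.
      rank_core_product r T q a m u * (T (Suc q) m t (u (Suc q)) * g t))"
    by (intro sum.cong refl sum.swap)
  also have "\<dots> = (\<Sum>t=1..r (Suc q). \<Sum>a=1..r 0. rank_core_product r T (Suc q) a t u * g t)"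
    by (simp add: sum_distrib_right mult.assoc)
  finally show ?case .
qed

text \<open>With weight 1 and boundary ranks 1, the sums over rows and columns collapse to the entry
  (1, 1).\<close>

lemma tt_tensor_eq_rank_core_product:
  assumes "r 0 = 1" "r q = 1"
  shows "tt_tensor q r T u = rank_core_product r T q 1 1 u"
  using sum_PiE_tensor_product_eq_rank_core_product [where g = "\<lambda>_. 1" and q = q and r = r
      and T = T and u = u] assms
  by (simp add: tt_tensor_def)

text \<open>Chain rule along the line through \<open>x\<close>. It turns total differentiability
  into the one-variable form that the product rule for \<open>deriv\<close> requires.\<close>

lemma has_derivative_imp_field_differentiable_line:
  fixes f :: "real^'d::finite \<Rightarrow> real"
  assumes "(f has_derivative f') (at x)"
  shows "(\<lambda>h. f (x + h *\<^sub>R v)) field_differentiable at 0"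
proof -
  have "((\<lambda>h. x + h *\<^sub>R v) has_derivative (\<lambda>h. h *\<^sub>R v)) (at 0)"
    by (auto intro!: derivative_eq_intros)
  moreover have "(f has_derivative f') (at (x + 0 *\<^sub>R v))"
    using assms by simp
  ultimately have "((\<lambda>h. f (x + h *\<^sub>R v)) has_derivative (\<lambda>h. f' (h *\<^sub>R v))) (at 0)"
    by (rule has_derivative_compose)
  then have "(\<lambda>h. f (x + h *\<^sub>R v)) differentiable at 0"
    by (rule differentiableI)
  then show ?thesis
    by (simp add: real_differentiable_def field_differentiable_def)
qed

lemma partial_deriv_mult:
  assumes "(\<lambda>h. f (x + h *\<^sub>R axis i 1)) field_differentiable at 0"
    and "(\<lambda>h. g (x + h *\<^sub>R axis i 1)) field_differentiable at 0"
  shows "partial_deriv i (\<lambda>y. f y * g y) x = f x * partial_deriv i g x + partial_deriv i f x * g x"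
  using deriv_mult [OF assms] by (simp add: partial_deriv_def)

lemma field_differentiable_prod:
  fixes f :: "'i \<Rightarrow> real \<Rightarrow> real"
  assumes "\<And>k. k \<in> A \<Longrightarrow> f k field_differentiable at z"
  shows "(\<lambda>h. \<Prod>k\<in>A. f k h) field_differentiable at z"
  using assms
  by (induction A rule: infinite_finite_induct) (auto intro!: field_differentiable_mult)

context
  fixes c :: "nat \<Rightarrow> 'd::finite"
    and p :: nat
    and \<psi> :: "nat \<Rightarrow> real^'d \<Rightarrow> nat \<Rightarrow> real"
    and x :: "real^'d"
    and u :: "nat \<Rightarrow> nat"
  assumes p: "p \<ge> 2"
    and diff: "\<And>k i. k \<in> {1..p} \<Longrightarrow>
      (\<lambda>h. \<psi> k (x + h *\<^sub>R axis i 1) (u k)) field_differentiable at 0"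
begin

private abbreviation (input) "rcp \<equiv> rank_core_product (grad_rank p CARD('d)) (grad_core c p \<psi> x)"

text \<open>The two summands mirror the nonzero entries of a core column: the derivative in row 1
  meets the plain product, and \<open>\<psi> (Suc q)\<close> meets the derivative accumulated so
  far.\<close>

lemma partial_deriv_prod_Suc:
  assumes "Suc q \<le> p"
  shows "partial_deriv i (\<lambda>y. \<Prod>k=1..Suc q. \<psi> k y (u k)) x =
    (\<Prod>k=1..q. \<psi> k x (u k)) * partial_deriv i (\<lambda>y. \<psi> (Suc q) y (u (Suc q))) x +
    partial_deriv i (\<lambda>y. \<Prod>k=1..q. \<psi> k y (u k)) x * \<psi> (Suc q) x (u (Suc q))"
proof -
  have "partial_deriv i (\<lambda>y. (\<Prod>k=1..q. \<psi> k y (u k)) * \<psi> (Suc q) y (u (Suc q))) x =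
    (\<Prod>k=1..q. \<psi> k x (u k)) * partial_deriv i (\<lambda>y. \<psi> (Suc q) y (u (Suc q))) x +
    partial_deriv i (\<lambda>y. \<Prod>k=1..q. \<psi> k y (u k)) x * \<psi> (Suc q) x (u (Suc q))"
    using assms by (intro partial_deriv_mult field_differentiable_prod diff) auto
  then show ?thesis
    by simp
qed

text \<open>Both claims go through one induction, since each new derivative entry also uses the
  undifferentiated product. It stops before \<open>p\<close>, where the core changes shape.\<close>

lemma rank_core_product_grad_core:
  assumes "1 \<le> q" "q < p"
  shows "rcp q 1 1 u = (\<Prod>k=1..q. \<psi> k x (u k)) \<and>
    (\<forall>i\<in>{1..CARD('d)}. rcp q 1 (Suc i) u =
       partial_deriv (c i) (\<lambda>y. \<Prod>k=1..q. \<psi> k y (u k)) x)"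
  using assms
proof (induction q rule: dec_induct)
  case base
  then show ?case
    by (simp add: grad_rank_def grad_core_def partial_vec_def)
next
  case (step q)
  have rank: "grad_rank p CARD('d) q = CARD('d) + 1"
    using step by (simp add: grad_rank_def)
  have core_first: "rcp q 1 m u * grad_core c p \<psi> x (Suc q) m 1 (u (Suc q)) =
      (if m = 1 then rcp q 1 1 u * \<psi> (Suc q) x (u (Suc q)) else 0)" for m
    using step by (simp add: grad_core_def)
  \<comment> \<open>Column \<open>Suc i\<close> is nonzero only in row 1 and on the diagonal, and
    these rows differ as \<open>i \<ge> 1\<close>. Two indicator terms let each sum over
    \<open>m\<close> pick one row.\<close>
  have core_Suc: "rcp q 1 m u * grad_core c p \<psi> x (Suc q) m (Suc i) (u (Suc q)) =
      (if m = 1 then rcp q 1 1 u * partial_deriv (c i) (\<lambda>y. \<psi> (Suc q) y (u (Suc q))) x else 0) +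
      (if m = Suc i then rcp q 1 (Suc i) u * \<psi> (Suc q) x (u (Suc q)) else 0)"
    if "i \<in> {1..CARD('d)}" for m i
    using step that by (auto simp: grad_core_def partial_vec_def)
  have "rcp (Suc q) 1 1 u = (\<Prod>k=1..Suc q. \<psi> k x (u k))"
    unfolding rank_core_product.simps rank core_first
    using step by (simp del: rank_core_product.simps sum.cl_ivl_Suc)
  moreover have "rcp (Suc q) 1 (Suc i) u =
      partial_deriv (c i) (\<lambda>y. \<Prod>k=1..Suc q. \<psi> k y (u k)) x" if "i \<in> {1..CARD('d)}" for i
  proof -
    have "rcp (Suc q) 1 (Suc i) u =
        rcp q 1 1 u * partial_deriv (c i) (\<lambda>y. \<psi> (Suc q) y (u (Suc q))) x +
        rcp q 1 (Suc i) u * \<psi> (Suc q) x (u (Suc q))"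
      unfolding rank_core_product.simps rank core_Suc [OF that] sum.distrib
      using that by (simp del: sum.cl_ivl_Suc)
    then show ?thesis
      using step that partial_deriv_prod_Suc [of q "c i"] by (simp del: rank_core_product.simps)
  qed
  ultimately show ?case
    by blast
qed

text \<open>The \<open>p\<close>-th core lacks the first column of its predecessors, so column
  \<open>i\<close> now does what column \<open>Suc i\<close> did before, with
  \<open>\<psi> p\<close> still in row \<open>Suc i\<close>.\<close>

lemma rank_core_product_grad_core_penultimate:
  assumes "i \<in> {1..CARD('d)}"
  shows "rcp p 1 i u = partial_deriv (c i) (\<lambda>y. \<Prod>k=1..p. \<psi> k y (u k)) x"
proof -
  \<comment> \<open>\<open>p \<ge> 2\<close> ensures that the induction result applies to
    \<open>q = p - 1\<close>.\<close>
  obtain q where q: "p = Suc q" "1 \<le> q"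
    using p by (cases p) auto
  have rank: "grad_rank p CARD('d) q = CARD('d) + 1"
    using q by (simp add: grad_rank_def)
  have core: "rcp q 1 m u * grad_core c p \<psi> x (Suc q) m i (u (Suc q)) =
      (if m = 1 then rcp q 1 1 u * partial_deriv (c i) (\<lambda>y. \<psi> (Suc q) y (u (Suc q))) x else 0) +
      (if m = Suc i then rcp q 1 (Suc i) u * \<psi> (Suc q) x (u (Suc q)) else 0)" for m
    using q assms by (auto simp: grad_core_def partial_vec_def)
  have "rcp (Suc q) 1 i u =
      rcp q 1 1 u * partial_deriv (c i) (\<lambda>y. \<psi> (Suc q) y (u (Suc q))) x +
      rcp q 1 (Suc i) u * \<psi> (Suc q) x (u (Suc q))"
    unfolding rank_core_product.simps rank core sum.distrib
    using assms by (simp del: sum.cl_ivl_Suc)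
  then show ?thesis
    using q assms partial_deriv_prod_Suc [of q "c i"] rank_core_product_grad_core [of q]
    by (simp del: rank_core_product.simps)
qed

text \<open>The stacked unit vectors select entry \<open>u (p + 1)\<close> of the row of partial
  derivatives; the range assumption places it among the summands.\<close>

lemma grad_tensor_eq_rank_core_product:
  assumes "u (p + 1) \<in> {1..CARD('d)}"
  shows "grad_tensor c p \<psi> x u = rcp (p + 1) 1 1 u"
proof -
  have "rcp (p + 1) 1 1 u = (\<Sum>m=1..CARD('d). rcp p 1 m u * unit_vec m (u (p + 1)))"
    using p by (simp add: grad_rank_def grad_core_def)
  also have "\<dots> = (\<Sum>m=1..CARD('d). if m = u (p + 1) then rcp p 1 m u else 0)"
    by (rule sum.cong) (auto simp: unit_vec_def)
  also have "\<dots> = rcp p 1 (u (p + 1)) u"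
    using assms by simp
  finally show ?thesis
    using rank_core_product_grad_core_penultimate [OF assms] by (simp add: grad_tensor_def)
qed

end

theorem corollary3p5:
  fixes X :: "(real^'d::finite) set"
    and c :: "nat \<Rightarrow> 'd"
    and p :: nat
    and n :: "nat \<Rightarrow> nat"
    and \<psi> :: "nat \<Rightarrow> real^'d \<Rightarrow> nat \<Rightarrow> real"
    and x :: "real^'d"
  assumes "bij_betw c {1..CARD('d)} UNIV"
    and "p \<ge> 2"
    and "open X"
    and "\<And>k u. k \<in> {1..p} \<Longrightarrow> u \<in> {1..n k} \<Longrightarrow> C2_on X (\<lambda>y. \<psi> k y u)"
    and "x \<in> X"
  shows "tt_representation (p + 1) (n(p + 1 := CARD('d))) (grad_rank p CARD('d))
           (grad_core c p \<psi> x) (grad_tensor c p \<psi> x) \<and>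
         (\<forall>u\<in>multi_indices (p + 1) (n(p + 1 := CARD('d))).
            grad_tensor c p \<psi> x u =
            rank_core_product (grad_rank p CARD('d)) (grad_core c p \<psi> x) (p + 1) 1 1 u)"
proof -
  have grad: "grad_tensor c p \<psi> x u =
      rank_core_product (grad_rank p CARD('d)) (grad_core c p \<psi> x) (p + 1) 1 1 u"
    if u: "u \<in> multi_indices (p + 1) (n(p + 1 := CARD('d)))" for u
  proof (rule grad_tensor_eq_rank_core_product [OF \<open>p \<ge> 2\<close>])
    have range: "u k \<in> {1..(n(p + 1 := CARD('d))) k}" if "k \<in> {1..p + 1}" for k
      using u that unfolding multi_indices_def by (rule PiE_mem)
    show "u (p + 1) \<in> {1..CARD('d)}"
      using range [of "p + 1"] by simp
    fix k i
    assume k: "k \<in> {1..p}"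
    \<comment> \<open>As \<open>k \<le> p\<close>, the mode size \<open>n k\<close> is untouched by
      the update at \<open>p + 1\<close>.\<close>
    then have "u k \<in> {1..n k}"
      using range [of k] by simp
    then have "C2_on X (\<lambda>y. \<psi> k y (u k))"
      using assms(4) k by blast
    then obtain f' where "((\<lambda>y. \<psi> k y (u k)) has_derivative f') (at x)"
      using \<open>x \<in> X\<close> unfolding C2_on_def by blast
    then show "(\<lambda>h. \<psi> k (x + h *\<^sub>R axis i 1) (u k)) field_differentiable at 0"
      by (rule has_derivative_imp_field_differentiable_line)
  qed
  have rank: "grad_rank p CARD('d) 0 = 1" "grad_rank p CARD('d) (p + 1) = 1"
    by (simp_all add: grad_rank_def)
  \<comment> \<open>This holds for every \<open>u\<close>, so rewriting with it reduces both
    conjuncts to \<open>grad\<close>.\<close>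
  have tt: "tt_tensor (p + 1) (grad_rank p CARD('d)) (grad_core c p \<psi> x) u =
      rank_core_product (grad_rank p CARD('d)) (grad_core c p \<psi> x) (p + 1) 1 1 u" for u
    using rank by (rule tt_tensor_eq_rank_core_product)
  show ?thesis
    unfolding tt_representation_def tt
    by (intro conjI ballI rank grad)
qed

end
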